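(* Let $\mathcal{L}=\sum_n \mathsf{L}(n,\mathbf{u}_0,\dots,\mathbf{u}_J)$ be a functional whose Lagrangian $\mathsf{L}$ is invariant under the action of an $R$-dimensional Lie group $G$, let $\rho_0$ be (the base component of) a right difference moving frame with generating invariants $\boldsymbol{\kappa}$, write $\mathcal{L}=\sum_n L(n,\boldsymbol{\kappa}_0,\dots,\boldsymbol{\kappa}_{J_1})$ with $\boldsymbol{\kappa}_j=\mathrm{S}_j\boldsymbol{\kappa}$, and suppose that the differential–difference syzygies are $\mathrm{d}\boldsymbol{\kappa}/\mathrm{d}t=\mathcal{H}\boldsymbol{\sigma}$, where $\sigma^\alpha=\rho_0\cdot(u_0^\alpha)'$ and $\mathcal{H}$ is a matrix of linear difference operators whose coefficients are functions of $\boldsymbol{\kappa}$ and its shifts. Let $A_{\mathcal{H}}$ be the boundary term, linear in the $\sigma^\alpha$ and their shifts, defined by $$\mathrm{E}_{\boldsymbol{\kappa}}(L)\cdot\mathcal{H}\boldsymbol{\sigma}-\big(\mathcal{H}^*\mathrm{E}_{\boldsymbol{\kappa}}(L)\big)\cdot\boldsymbol{\sigma}=(\mathrm{S}-\mathrm{id})A_{\mathcal{H}},$$ and write $$A_{\mathcal{H}}=\mathcal{C}^{j}_{\alpha}\,\mathrm{S}_j(\sigma^{\alpha})\qquad(\text{summed over }j,\alpha),$$ where each $\mathcal{C}^{j}_{\alpha}$ depends only on $n$, $\boldsymbol{\kappa}$ and its shifts. Let $\Phi^{\alpha}(\mathbf{u}_0)$ be the row of the matrix of characteristics corresponding to the dependent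 variable $u^{\alpha}_0$ and denote its invariantization by $\Phi^{\alpha}_0(I)=\Phi^{\alpha}(\rho_0\cdot\mathbf{u}_0)$. Then the $R$ conservation laws (holding on all solutions of the invariantized Euler–Lagrange equations $\mathcal{H}^*\mathrm{E}_{\boldsymbol{\kappa}}(L)=0$), in row vector form, amount to $$(\mathrm{S}-\mathrm{id})\Big(\mathcal{C}_{\alpha}^{j}\,\mathrm{S}_j\{\Phi^{\alpha}_0(I)\,\mathcal{A}d(\rho_{0})\}\Big)=0.$$ That is, to obtain the conservation laws, it is sufficient to make the replacement $$\sigma^\alpha \mapsto \{\Phi^{\alpha}(g\cdot \mathbf{u}_0)\,\mathcal{A}d(g)\} \big\vert_{g=\rho_0}$$ in $A_{\mathcal{H}}$.
   Context: Setting. The independent variable is $n\in\mathbb{Z}$; the dependent variables are $\mathbf{u}=(u^1,\dots,u^q)\in U\subset\mathbb{R}^q$, and $\mathbf{u}_j=\mathbf{u}(n+j)$. The shift operator is $\mathrm{S}:n\mapsto n+1$, $\mathrm{S}:u^\alpha_j\mapsto u^\alpha_{j+1}$, with powers $\mathrm{S}_j=\mathrm{S}^j$, $j\in\mathbb{Z}$; $\mathrm{id}$ is the identity operator. All calculations are formal, local and smooth. Repeated indices are summed. The prolongation space $P_n^{(J_0,J)}(U)$, $J_0\le0\le J$, over the fixed arbitrary base point $n$ is the product of $J-J_0+1$ copies of $U$ with coordinates $z=(\mathbf{u}_{J_0},\dots,\mathbf{u}_J)$; prolongation spaces are taken as large as needed. Group action and frame. A Lie group $G$ of dimension $R$ acts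 smoothly (left action) on $U$ and diagonally on prolongation spaces; the action on the relevant prolongation space (or a suitable domain of it) is free and regular. A right moving frame is a map $\rho_0$ from (a domain in) the prolongation space to $G$ with $\rho_0(g\cdot z)=\rho_0(z)g^{-1}$, determined by a cross-section $\mathcal{K}_0$ transverse to the orbits: $\rho_0(z)$ is the unique group element taking $z$ to $\mathcal{K}_0$. A difference moving frame is the sequence $\rho_k=\mathrm{S}_k\rho_0$. A set of invariants is generating if every difference invariant is a function of its elements and their shifts. Variations. Let $\mathbf{u}=\mathbf{u}(t)$ depend smoothly on an auxiliary parameter $t$ (invariant under $G$), with $'=\mathrm{d}/\mathrm{d}t$; $\rho_0\cdot (u_0^\alpha)'=\big(\tfrac{\mathrm{d}}{\mathrm{d}t}(g\cdot u_0^\alpha)\big)\big|_{g=\rho_0}$ (group element held fixed while differentiating). Operators. $\mathrm{E}_{\kappa^\beta}(L)=\sum_j\mathrm{S}_{-j}\big(\partial L/\partial\kappa^\beta_j\big)$ is the difference Euler operator with respect to $\kappa^\beta$. The adjoint of $\mathcal{H}=\sum_j c_j\mathrm{S}_j$ is $\mathcal{H}^*(F)=\sum_j\mathrm{S}_{-j}(c_jF)$; for a matrix of operators, $(\mathcal{H}^* )_{\alpha\beta}=(\mathcal{H}_{\beta\alpha})^*$. Infinitesimals. Parametrize $G$ near the identity $e$ by $\mathbf{a}=(a^1,\dots,a^R)\mapsto\Gamma(\mathbf{a})$, $\Gamma(\mathbf{0})=e$. The infinitesimal generators are $\mathbf{v}_r=\xi^\alpha_r(\mathbf{u})\partial_{u^\alpha}$,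 $\xi_r^\alpha(\mathbf{u})=\partial(\Gamma(\mathbf{a})\cdot\mathbf{u})^\alpha/\partial a^r|_{\mathbf{a}=\mathbf{0}}$, $r=1,\dots,R$; they are taken to form a basis of the space of infinitesimal generators. The matrix of characteristics is the $q\times R$ matrix $\Phi(\mathbf{u})=(\xi_r^\alpha(\mathbf{u}))$, with rows $\Phi^\alpha$. For $g\in G$, with $\widetilde{\mathbf{u}}=g\cdot\mathbf{u}$ and $\widetilde{\mathbf{v}}_r=\xi_r^\alpha(\widetilde{\mathbf{u}})\partial_{\tilde u^\alpha}$, the $R\times R$ matrix $\mathcal{A}d(g)$ (adjoint representation) is defined by $(\mathbf{v}_1\ \cdots\ \mathbf{v}_R)=(\widetilde{\mathbf{v}}_1\ \cdots\ \widetilde{\mathbf{v}}_R)\,\mathcal{A}d(g)$. The $R$ conservation laws. For each $r$, let $\gamma_r(t)=\Gamma(0,\dots,0,t,0,\dots,0)$ ($t$ in position $r$). The $r$-th conservation law is the relation $(\mathrm{S}-\mathrm{id})A_{\mathcal{H}}=0$, holding on all solutions of $\mathcal{H}^*\mathrm{E}_{\boldsymbol{\kappa}}(L)=0$, in which the variation is along the group path $\gamma_r$, i.e. $\sigma^\alpha$ is evaluated as $\frac{\mathrm{d}}{\mathrm{d}t}\big|_{t=0}\big(g\cdot\gamma_r(t)\cdot u_0^\alpha\big)\big|_{g=\rho_0}$. The row vector form lists the laws for $r=1,\dots,R$. *)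

theory Defs
  imports "HOL-Analysis.Analysis" "HOL-Algebra.Group_Action"
begin

section \<open>Smooth functions\<close>

text \<open>On an open set \<open>S\<close> this is the usual notion of a \<open>k\<close> times continuously
  differentiable function.\<close>

primrec Ck_on :: "nat \<Rightarrow> 'a::real_normed_vector set \<Rightarrow> ('a \<Rightarrow> 'b::real_normed_vector) \<Rightarrow> bool"
where
  "Ck_on 0 S f \<longleftrightarrow> continuous_on S f"
| "Ck_on (Suc k) S f \<longleftrightarrow> (\<forall>x\<in>S. f differentiable (at x)) \<and>
     (\<forall>v. Ck_on k S (\<lambda>x. frechet_derivative f (at x) v))"

definition C_inf_on :: "'a::real_normed_vector set \<Rightarrow> ('a \<Rightarrow> 'b::real_normed_vector) \<Rightarrow> bool"
  where "C_inf_on S f \<longleftrightarrow> (\<forall>k. Ck_on k S f)"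

text \<open>A point of a prolongation space is a function \<open>z\<close> on (a set of) integers, with
  \<open>z j\<close> the value of the dependent variables at \<open>n + j\<close>.  A finite set of real coordinates has no
  type of its own when the window varies, so smoothness is expressed by continuity (in the product
  topology) of all iterated partial derivatives in the coordinates with index in \<open>W\<close>. For
  functions of finitely many \<open>z j\<close> on a domain that is open in these coordinates this is the usual
  notion.\<close>

definition coord_deriv ::
    "int \<Rightarrow> 'a::real_normed_vector \<Rightarrow> ((int \<Rightarrow> 'a) \<Rightarrow> 'b::real_normed_vector) \<Rightarrow> (int \<Rightarrow> 'a) \<Rightarrow> 'b"
  where "coord_deriv j b F z =
    vector_derivative (\<lambda>s. F (z(j := z j + s *\<^sub>R b))) (at 0)"

primrec coord_Ck_on ::
    "nat \<Rightarrow> int set \<Rightarrow> (int \<Rightarrow> 'a::euclidean_space) set \<Rightarrow> ((int \<Rightarrow> 'a) \<Rightarrow> 'b::real_normed_vector) \<Rightarrow> bool"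
where
  "coord_Ck_on 0 W N F \<longleftrightarrow> continuous_on N F"
| "coord_Ck_on (Suc k) W N F \<longleftrightarrow> continuous_on N F \<and>
     (\<forall>j\<in>W. \<forall>b\<in>Basis.
        (\<forall>z\<in>N. (\<lambda>s::real. F (z(j := z j + s *\<^sub>R b))) differentiable (at 0)) \<and>
        coord_Ck_on k W N (coord_deriv j b F))"

definition coord_smooth_on ::
    "int set \<Rightarrow> (int \<Rightarrow> 'a::euclidean_space) set \<Rightarrow> ((int \<Rightarrow> 'a) \<Rightarrow> 'b::real_normed_vector) \<Rightarrow> bool"
  where "coord_smooth_on W N F \<longleftrightarrow> (\<forall>k. coord_Ck_on k W N F)"

text \<open>Smooth functions of \<open>z j\<close> for \<open>A \<le> j \<le> B\<close> only.\<close>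

definition local_smooth_on ::
    "int \<Rightarrow> int \<Rightarrow> (int \<Rightarrow> 'a::euclidean_space) set \<Rightarrow> ((int \<Rightarrow> 'a) \<Rightarrow> 'b::real_normed_vector) \<Rightarrow> bool"
  where "local_smooth_on A B N F \<longleftrightarrow>
    (\<forall>z\<in>N. \<forall>z'\<in>N. (\<forall>j\<in>{A..B}. z j = z' j) \<longrightarrow> F z = F z') \<and> coord_smooth_on UNIV N F"


section \<open>Lie groups\<close>

definition chart :: "'g topology \<Rightarrow> 'g set \<times> ('g \<Rightarrow> real^'r) \<Rightarrow> bool"
  where "chart X c \<longleftrightarrow> (case c of (V, \<phi>) \<Rightarrow> openin X V \<and> open (\<phi> ` V) \<and>
    homeomorphic_map (subtopology X V) (top_of_set (\<phi> ` V)) \<phi>)"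

definition compatible_charts ::
    "'g set \<times> ('g \<Rightarrow> real^'r) \<Rightarrow> 'g set \<times> ('g \<Rightarrow> real^'r) \<Rightarrow> bool"
  where "compatible_charts c d \<longleftrightarrow> (case c of (V, \<phi>) \<Rightarrow> case d of (W, \<psi>) \<Rightarrow>
    C_inf_on (\<phi> ` (V \<inter> W)) (\<psi> \<circ> inv_into V \<phi>) \<and>
    C_inf_on (\<psi> ` (V \<inter> W)) (\<phi> \<circ> inv_into W \<psi>))"

definition maximal_atlas :: "'g topology \<Rightarrow> ('g set \<times> ('g \<Rightarrow> real^'r)) set \<Rightarrow> bool"
  where "maximal_atlas X \<A> \<longleftrightarrow>
    (\<forall>c\<in>\<A>. chart X c) \<and> (\<Union>c\<in>\<A>. fst c) = topspace X \<and>
    (\<forall>c\<in>\<A>. \<forall>d\<in>\<A>. compatible_charts c d) \<and>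
    (\<forall>c. chart X c \<and> (\<forall>d\<in>\<A>. compatible_charts c d) \<longrightarrow> c \<in> \<A>)"

locale lie_group = group G for G :: "'g monoid" (structure) +
  fixes X :: "'g topology"
    and \<A> :: "('g set \<times> ('g \<Rightarrow> real^'r)) set"
  assumes topspace_eq: "topspace X = carrier G"
    and hausdorff: "Hausdorff_space X"
    and second_countable: "second_countable X"
    and atlas: "maximal_atlas X \<A>"
    and mult_continuous: "continuous_map (prod_topology X X) X (\<lambda>(g, h). g \<otimes> h)"
    and inv_continuous: "continuous_map X X (\<lambda>g. inv g)"
    and mult_smooth:
      "\<And>V\<^sub>1 \<phi>\<^sub>1 V\<^sub>2 \<phi>\<^sub>2 V\<^sub>3 \<phi>\<^sub>3. \<lbrakk> (V\<^sub>1, \<phi>\<^sub>1) \<in> \<A>; (V\<^sub>2, \<phi>\<^sub>2) \<in> \<A>; (V\<^sub>3, \<phi>\<^sub>3) \<in> \<A> \<rbrakk> \<Longrightarrow>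
        C_inf_on {(\<phi>\<^sub>1 g, \<phi>\<^sub>2 h) | g h. g \<in> V\<^sub>1 \<and> h \<in> V\<^sub>2 \<and> g \<otimes> h \<in> V\<^sub>3}
          (\<lambda>(a, b). \<phi>\<^sub>3 (inv_into V\<^sub>1 \<phi>\<^sub>1 a \<otimes> inv_into V\<^sub>2 \<phi>\<^sub>2 b))"
    and inv_smooth:
      "\<And>V\<^sub>1 \<phi>\<^sub>1 V\<^sub>2 \<phi>\<^sub>2. \<lbrakk> (V\<^sub>1, \<phi>\<^sub>1) \<in> \<A>; (V\<^sub>2, \<phi>\<^sub>2) \<in> \<A> \<rbrakk> \<Longrightarrow>
        C_inf_on {\<phi>\<^sub>1 g | g. g \<in> V\<^sub>1 \<and> inv g \<in> V\<^sub>2} (\<lambda>a. \<phi>\<^sub>2 (inv (inv_into V\<^sub>1 \<phi>\<^sub>1 a)))"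


section \<open>Infinitesimal generators and the adjoint representation\<close>

text \<open>The one-parameter path \<open>\<gamma>\<^sub>r\<close> with only the \<open>r\<close>-th group parameter nonzero.\<close>

definition param_path :: "(real^'r \<Rightarrow> 'g) \<Rightarrow> 'r \<Rightarrow> real \<Rightarrow> 'g"
  where "param_path \<Gamma> r t = \<Gamma> (axis r t)"

definition generator ::
    "(real^'r \<Rightarrow> 'g) \<Rightarrow> ('g \<Rightarrow> real^'q \<Rightarrow> real^'q) \<Rightarrow> 'r \<Rightarrow> real^'q \<Rightarrow> real^'q"
  where "generator \<Gamma> act r x = vector_derivative (\<lambda>t. act (param_path \<Gamma> r t) x) (at 0)"

definition characteristics ::
    "(real^'r \<Rightarrow> 'g) \<Rightarrow> ('g \<Rightarrow> real^'q \<Rightarrow> real^'q) \<Rightarrow> real^'q \<Rightarrow> real^'r^'q"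
  where "characteristics \<Gamma> act x = (\<chi> \<alpha> r. generator \<Gamma> act r x $ \<alpha>)"

text \<open>The matrix \<open>A\<close> with
  \<open>(v\<^sub>1 \<dots> v\<^sub>R) = (v'\<^sub>1 \<dots> v'\<^sub>R) A\<close>, where \<open>v'\<^sub>s\<close> is the \<open>s\<close>-th generator written in the coordinates
  \<open>g \<cdot> u\<close>.  Both sides are vector fields; their components with respect to the
  coordinates \<open>g \<cdot> u\<close> at the point \<open>x\<close> are compared, so those of \<open>v\<^sub>r\<close> are obtained with the Jacobian
  of \<open>u \<mapsto> g \<cdot> u\<close>.\<close>

definition Ad_matrix ::
    "(real^'r \<Rightarrow> 'g) \<Rightarrow> ('g \<Rightarrow> real^'q \<Rightarrow> real^'q) \<Rightarrow> (real^'q) set \<Rightarrow> 'g \<Rightarrow> real^'r^'r"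
  where "Ad_matrix \<Gamma> act U g = (THE A. \<forall>x\<in>U. \<forall>r.
    frechet_derivative (act g) (at x) (generator \<Gamma> act r x) =
    (\<Sum>s\<in>UNIV. A $ s $ r *\<^sub>R generator \<Gamma> act s (act g x)))"


section \<open>Smooth actions, prolongation and moving frames\<close>

text \<open>\<open>\<Gamma>\<close> is the inverse of a chart around the identity.  Independence of the generators makes
  them a basis of the space of infinitesimal generators, because every derivative of a smooth curve
  through the identity is a linear combination of the derivatives along the coordinate axes.\<close>

locale smooth_action = lie_group G X \<A> + group_action G U act
  for G :: "'g monoid" (structure)
    and X :: "'g topology"
    and \<A> :: "('g set \<times> ('g \<Rightarrow> real^'r)) set"
    and U :: "(real^'q) set"
    and act :: "'g \<Rightarrow> real^'q \<Rightarrow> real^'q" +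
  fixes \<Gamma> :: "real^'r \<Rightarrow> 'g"
    and B :: "(real^'r) set"
  assumes open_U: "open U"
    and act_smooth: "\<And>V \<phi>. (V, \<phi>) \<in> \<A> \<Longrightarrow>
      C_inf_on ((\<phi> ` V) \<times> U) (\<lambda>(a, x). act (inv_into V \<phi> a) x)"
    and open_B: "open B"
    and zero_in_B: "0 \<in> B"
    and \<Gamma>_zero: "\<Gamma> 0 = \<one>"
    and \<Gamma>_inj: "inj_on \<Gamma> B"
    and \<Gamma>_chart: "(\<Gamma> ` B, inv_into B \<Gamma>) \<in> \<A>"
    and generators_independent:
      "\<And>c :: real^'r. (\<forall>x\<in>U. (\<Sum>r\<in>UNIV. c $ r *\<^sub>R generator \<Gamma> act r x) = 0) \<Longrightarrow> c = 0"

definition prolongation :: "int \<Rightarrow> int \<Rightarrow> 'u set \<Rightarrow> (int \<Rightarrow> 'u) set"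
  where "prolongation J\<^sub>0 J U = (\<Pi>\<^sub>E j\<in>{J\<^sub>0..J}. U)"

text \<open>The diagonal action on functions on the index set \<open>W\<close>.\<close>

definition prolonged_action ::
    "int set \<Rightarrow> ('g \<Rightarrow> 'u \<Rightarrow> 'u) \<Rightarrow> 'g \<Rightarrow> (int \<Rightarrow> 'u) \<Rightarrow> int \<Rightarrow> 'u"
  where "prolonged_action W act g z = (\<lambda>j\<in>W. act g (z j))"

text \<open>Orbits of a free action all have the dimension of \<open>G\<close>, so only the second half of the
  usual definition of regularity is required here.\<close>

definition free_and_regular ::
    "('g, 'k) monoid_scheme \<Rightarrow> ('g \<Rightarrow> 'p \<Rightarrow> 'p) \<Rightarrow> 'p::topological_space set \<Rightarrow> bool"
  where "free_and_regular G pact M \<longleftrightarrow>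
    (\<forall>z\<in>M. \<forall>g\<in>carrier G. pact g z = z \<longrightarrow> g = \<one>\<^bsub>G\<^esub>) \<and>
    (\<forall>z\<in>M. \<forall>N. openin (top_of_set M) N \<and> z \<in> N \<longrightarrow>
       (\<exists>N'. N' \<subseteq> N \<and> openin (top_of_set M) N' \<and> z \<in> N' \<and>
          (\<forall>w\<in>M. connected (N' \<inter> orbit G pact w))))"

text \<open>A submanifold \<open>K\<close> of codimension \<open>R\<close> transverse to the orbits: locally the zero set of \<open>R\<close>
  functions whose derivative in the group directions is invertible.\<close>

definition transverse_cross_section ::
    "(real^'r \<Rightarrow> 'g) \<Rightarrow> ('g \<Rightarrow> real^'q \<Rightarrow> real^'q) \<Rightarrow> int \<Rightarrow> int \<Rightarrow>
     (int \<Rightarrow> real^'q) set \<Rightarrow> (int \<Rightarrow> real^'q) set \<Rightarrow> bool"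
  where "transverse_cross_section \<Gamma> act J\<^sub>0 J M K \<longleftrightarrow> K \<subseteq> M \<and>
    (\<forall>z\<in>K. \<exists>N (\<psi> :: (int \<Rightarrow> real^'q) \<Rightarrow> real^'r) T.
       openin (top_of_set M) N \<and> z \<in> N \<and> coord_smooth_on {J\<^sub>0..J} N \<psi> \<and>
       K \<inter> N = {w \<in> N. \<psi> w = 0} \<and>
       ((\<lambda>a. \<psi> (prolonged_action {J\<^sub>0..J} act (\<Gamma> a) z)) has_derivative T) (at 0) \<and> bij T)"

text \<open>\<open>M\<close> is the domain of the frame in the prolongation space with coordinates
  \<open>(u\<^bsub>J\<^sub>0\<^esub>, \<dots>, u\<^sub>J)\<close>.\<close>

locale right_moving_frame = smooth_action G X \<A> U act \<Gamma> B
  for G :: "'g monoid" (structure)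
    and X :: "'g topology"
    and \<A> :: "('g set \<times> ('g \<Rightarrow> real^'r)) set"
    and U :: "(real^'q) set"
    and act :: "'g \<Rightarrow> real^'q \<Rightarrow> real^'q"
    and \<Gamma> :: "real^'r \<Rightarrow> 'g"
    and B :: "(real^'r) set" +
  fixes J\<^sub>0 J :: int
    and M K :: "(int \<Rightarrow> real^'q) set"
    and \<rho> :: "(int \<Rightarrow> real^'q) \<Rightarrow> 'g"
  assumes window: "J\<^sub>0 \<le> 0" "0 \<le> J"
    and M_open: "openin (top_of_set (prolongation J\<^sub>0 J U)) M"
    and M_invariant: "\<And>g z. \<lbrakk> g \<in> carrier G; z \<in> M \<rbrakk> \<Longrightarrow> prolonged_action {J\<^sub>0..J} act g z \<in> M"
    and action_free_regular: "free_and_regular G (prolonged_action {J\<^sub>0..J} act) M"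
    and cross_section: "transverse_cross_section \<Gamma> act J\<^sub>0 J M K"
    and frame_continuous: "continuous_map (top_of_set M) X \<rho>"
    and frame_smooth: "\<And>V \<phi>. (V, \<phi>) \<in> \<A> \<Longrightarrow>
      coord_smooth_on {J\<^sub>0..J} {z \<in> M. \<rho> z \<in> V} (\<phi> \<circ> \<rho>)"
    and frame_closed: "\<And>z. z \<in> M \<Longrightarrow> \<rho> z \<in> carrier G"
    and frame_section: "\<And>z g. \<lbrakk> z \<in> M; g \<in> carrier G \<rbrakk> \<Longrightarrow>
      prolonged_action {J\<^sub>0..J} act g z \<in> K \<longleftrightarrow> g = \<rho> z"
    and frame_equivariant: "\<And>g z. \<lbrakk> g \<in> carrier G; z \<in> M \<rbrakk> \<Longrightarrow>
      \<rho> (prolonged_action {J\<^sub>0..J} act g z) = \<rho> z \<otimes> inv g"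


section \<open>Difference functions and operators\<close>

definition shift_seq :: "int \<Rightarrow> (int \<Rightarrow> 'a) \<Rightarrow> int \<Rightarrow> 'a"
  where "shift_seq k z = (\<lambda>j. z (j + k))"

text \<open>The shift \<open>S\<^sub>k\<close> on functions of \<open>n\<close> and the \<open>z j\<close>.\<close>

definition shift :: "int \<Rightarrow> (int \<Rightarrow> (int \<Rightarrow> 'a) \<Rightarrow> 'b) \<Rightarrow> int \<Rightarrow> (int \<Rightarrow> 'a) \<Rightarrow> 'b"
  where "shift k F = (\<lambda>n z. F (n + k) (shift_seq k z))"

text \<open>Bi-infinite sequences for which the frame is defined at every base point, and the frame as a
  function of such a sequence; \<open>\<rho>\<^sub>k\<close> is the base frame at \<open>shift_seq k z\<close>.\<close>

definition frame_domain :: "int \<Rightarrow> int \<Rightarrow> (int \<Rightarrow> 'u) set \<Rightarrow> (int \<Rightarrow> 'u) set"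
  where "frame_domain J\<^sub>0 J M = {z. \<forall>k. restrict (shift_seq k z) {J\<^sub>0..J} \<in> M}"

definition base_frame :: "int \<Rightarrow> int \<Rightarrow> ((int \<Rightarrow> 'u) \<Rightarrow> 'g) \<Rightarrow> (int \<Rightarrow> 'u) \<Rightarrow> 'g"
  where "base_frame J\<^sub>0 J \<rho> z = \<rho> (restrict z {J\<^sub>0..J})"

definition difference_invariant ::
    "('g, 'k) monoid_scheme \<Rightarrow> ('g \<Rightarrow> real^'q \<Rightarrow> real^'q) \<Rightarrow> (int \<Rightarrow> real^'q) set \<Rightarrow>
     ((int \<Rightarrow> real^'q) \<Rightarrow> 'b::real_normed_vector) \<Rightarrow> bool"
  where "difference_invariant G act D I \<longleftrightarrow>
    (\<exists>A B. local_smooth_on A B D I) \<and>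
    (\<forall>g\<in>carrier G. \<forall>z\<in>D. I (prolonged_action UNIV act g z) = I z)"

text \<open>The sequence \<open>(\<kappa>\<^sub>j)\<^sub>j\<close> at a point.\<close>

definition invariant_seq :: "((int \<Rightarrow> 'u) \<Rightarrow> 'm) \<Rightarrow> (int \<Rightarrow> 'u) \<Rightarrow> int \<Rightarrow> 'm"
  where "invariant_seq \<kappa> z = (\<lambda>j. \<kappa> (shift_seq j z))"

definition generating_invariants ::
    "('g, 'k) monoid_scheme \<Rightarrow> ('g \<Rightarrow> real^'q \<Rightarrow> real^'q) \<Rightarrow> (int \<Rightarrow> real^'q) set \<Rightarrow>
     ((int \<Rightarrow> real^'q) \<Rightarrow> real^'m) \<Rightarrow> bool"
  where "generating_invariants G act D \<kappa> \<longleftrightarrow> difference_invariant G act D \<kappa> \<and>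
    (\<forall>I :: (int \<Rightarrow> real^'q) \<Rightarrow> real. difference_invariant G act D I \<longrightarrow>
       (\<exists>A B f. \<forall>z\<in>D. I z = f (restrict (invariant_seq \<kappa> z) {A..B})))"

text \<open>Smooth functions of \<open>\<kappa>\<^sub>A, \<dots>, \<kappa>\<^sub>B\<close>.  They are defined near the values taken by the invariants,
  since these values need not form an open set.\<close>

definition local_smooth_near ::
    "int \<Rightarrow> int \<Rightarrow> (int \<Rightarrow> 'a::euclidean_space) set \<Rightarrow> ((int \<Rightarrow> 'a) \<Rightarrow> 'b::real_normed_vector) \<Rightarrow> bool"
  where "local_smooth_near A B S f \<longleftrightarrow> (\<exists>\<Omega>. open \<Omega> \<and> S \<subseteq> \<Omega> \<and> local_smooth_on A B \<Omega> f)"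

text \<open>Formal sums over all \<open>n\<close> agree if their summands differ by a total difference.\<close>

definition same_functional ::
    "(int \<Rightarrow> real^'q) set \<Rightarrow> (int \<Rightarrow> (int \<Rightarrow> real^'q) \<Rightarrow> real) \<Rightarrow> (int \<Rightarrow> (int \<Rightarrow> real^'q) \<Rightarrow> real) \<Rightarrow> bool"
  where "same_functional D L\<^sub>1 L\<^sub>2 \<longleftrightarrow> (\<exists>A B F. (\<forall>n. local_smooth_on A B D (F n)) \<and>
    (\<forall>n. \<forall>z\<in>D. L\<^sub>1 n z - L\<^sub>2 n z = shift 1 F n z - F n z))"

text \<open>\<open>S\<^sub>-\<^sub>j (\<partial>L / \<partial>\<kappa>\<^sub>j)\<close> summed over the window \<open>0 \<le> j \<le> J\<^sub>1\<close> on which \<open>L\<close> depends.\<close>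

definition euler_operator ::
    "int \<Rightarrow> (int \<Rightarrow> (int \<Rightarrow> real^'m) \<Rightarrow> real) \<Rightarrow> int \<Rightarrow> (int \<Rightarrow> real^'m) \<Rightarrow> real^'m"
  where "euler_operator J\<^sub>1 L n k =
    (\<chi> \<beta>. \<Sum>j\<in>{0..J\<^sub>1}. shift (- j) (\<lambda>n. coord_deriv j (axis \<beta> 1) (L n)) n k)"

text \<open>A matrix of difference operators \<open>\<Sum>\<^sub>j h\<^sub>j S\<^sub>j\<close> is given by a finite index set \<open>S\<close> and coefficient
  matrices \<open>h j\<close>, functions of the invariants and their shifts.  It acts on vectors of
  functions of \<open>n\<close> and \<open>u\<close>, its adjoint here on vectors of functions of \<open>n\<close> and \<open>\<kappa>\<close>.\<close>

definition diff_operator ::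
    "((int \<Rightarrow> 'u) \<Rightarrow> real^'m) \<Rightarrow> int set \<Rightarrow> (int \<Rightarrow> (int \<Rightarrow> real^'m) \<Rightarrow> real^'q^'m) \<Rightarrow>
     (int \<Rightarrow> (int \<Rightarrow> 'u) \<Rightarrow> real^'q) \<Rightarrow> int \<Rightarrow> (int \<Rightarrow> 'u) \<Rightarrow> real^'m"
  where "diff_operator \<kappa> S h \<sigma> n z =
    (\<Sum>j\<in>S. h j (invariant_seq \<kappa> z) *v shift j \<sigma> n z)"

definition adjoint_operator ::
    "int set \<Rightarrow> (int \<Rightarrow> (int \<Rightarrow> real^'m) \<Rightarrow> real^'q^'m) \<Rightarrow>
     (int \<Rightarrow> (int \<Rightarrow> real^'m) \<Rightarrow> real^'m) \<Rightarrow> int \<Rightarrow> (int \<Rightarrow> real^'m) \<Rightarrow> real^'q"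
  where "adjoint_operator S h F n k =
    (\<chi> \<alpha>. \<Sum>\<beta>\<in>UNIV. \<Sum>j\<in>S. shift (- j) (\<lambda>n k. h j k $ \<beta> $ \<alpha> * F n k $ \<beta>) n k)"

text \<open>The expression \<open>C\<^sup>j\<^sub>\<alpha> S\<^sub>j(\<sigma>\<^sup>\<alpha>)\<close>, linear in \<open>\<sigma>\<close>.\<close>

definition boundary_term ::
    "((int \<Rightarrow> 'u) \<Rightarrow> real^'m) \<Rightarrow> int set \<Rightarrow> (int \<Rightarrow> int \<Rightarrow> (int \<Rightarrow> real^'m) \<Rightarrow> real^'q) \<Rightarrow>
     (int \<Rightarrow> (int \<Rightarrow> 'u) \<Rightarrow> real^'q) \<Rightarrow> int \<Rightarrow> (int \<Rightarrow> 'u) \<Rightarrow> real"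
  where "boundary_term \<kappa> S C \<sigma> n z =
    (\<Sum>j\<in>S. \<Sum>\<alpha>\<in>UNIV. C j n (invariant_seq \<kappa> z) $ \<alpha> * shift j (\<lambda>n z. \<sigma> n z $ \<alpha>) n z)"

text \<open>\<open>E\<^sub>\<kappa>(L) \<cdot> H\<sigma> - (H\<^sup>* E\<^sub>\<kappa>(L)) \<cdot> \<sigma> = (S - id) A\<^sub>H\<close> as an identity in an indeterminate \<open>\<sigma>\<close>.\<close>

definition is_boundary_term ::
    "((int \<Rightarrow> 'u) \<Rightarrow> real^'m) \<Rightarrow> (int \<Rightarrow> 'u) set \<Rightarrow> int \<Rightarrow> (int \<Rightarrow> (int \<Rightarrow> real^'m) \<Rightarrow> real) \<Rightarrow>
     int set \<Rightarrow> (int \<Rightarrow> (int \<Rightarrow> real^'m) \<Rightarrow> real^'q^'m) \<Rightarrow>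
     int set \<Rightarrow> (int \<Rightarrow> int \<Rightarrow> (int \<Rightarrow> real^'m) \<Rightarrow> real^'q) \<Rightarrow> bool"
  where "is_boundary_term \<kappa> D J\<^sub>1 L S h S' C \<longleftrightarrow>
    (\<forall>\<sigma> n. \<forall>z\<in>D.
       euler_operator J\<^sub>1 L n (invariant_seq \<kappa> z) \<bullet> diff_operator \<kappa> S h \<sigma> n z -
       adjoint_operator S h (euler_operator J\<^sub>1 L) n (invariant_seq \<kappa> z) \<bullet> \<sigma> n z =
       shift 1 (boundary_term \<kappa> S' C \<sigma>) n z - boundary_term \<kappa> S' C \<sigma> n z)"


section \<open>Variations\<close>

text \<open>\<open>\<rho>\<^sub>0 \<cdot> (u\<^sub>0)'\<close> at parameter value \<open>t\<close> along the variation \<open>v\<close>.\<close>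

definition invariantized_variation ::
    "('g \<Rightarrow> real^'q \<Rightarrow> real^'q) \<Rightarrow> ((int \<Rightarrow> real^'q) \<Rightarrow> 'g) \<Rightarrow> (real \<Rightarrow> int \<Rightarrow> real^'q) \<Rightarrow> real \<Rightarrow> real^'q"
  where "invariantized_variation act \<rho> v t =
    vector_derivative (\<lambda>s. act (\<rho> (v t)) (v s 0)) (at t)"

text \<open>\<open>d\<kappa>/dt = H\<sigma>\<close> for all variations; \<open>S\<^sub>j\<sigma>\<close> is \<open>\<sigma>\<close> along the shifted variation.\<close>

definition syzygies ::
    "('g \<Rightarrow> real^'q \<Rightarrow> real^'q) \<Rightarrow> ((int \<Rightarrow> real^'q) \<Rightarrow> 'g) \<Rightarrow> (int \<Rightarrow> real^'q) set \<Rightarrow>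
     ((int \<Rightarrow> real^'q) \<Rightarrow> real^'m) \<Rightarrow> int set \<Rightarrow> (int \<Rightarrow> (int \<Rightarrow> real^'m) \<Rightarrow> real^'q^'m) \<Rightarrow> bool"
  where "syzygies act \<rho> D \<kappa> S h \<longleftrightarrow>
    (\<forall>T v. open T \<and> (\<forall>j. C_inf_on T (\<lambda>t. v t j)) \<and> (\<forall>t\<in>T. v t \<in> D) \<longrightarrow>
       (\<forall>t\<in>T. ((\<lambda>s. \<kappa> (v s)) has_vector_derivative
          (\<Sum>j\<in>S. h j (invariant_seq \<kappa> (v t)) *v
             invariantized_variation act \<rho> (\<lambda>s. shift_seq j (v s)) t)) (at t)))"

text \<open>\<open>d/dt|\<^bsub>t=0\<^esub> (g \<cdot> \<gamma>\<^sub>r(t) \<cdot> u\<^sub>0)\<close> with \<open>g = \<rho>\<^sub>0\<close>.\<close>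

definition group_variation ::
    "(real^'r \<Rightarrow> 'g) \<Rightarrow> ('g \<Rightarrow> real^'q \<Rightarrow> real^'q) \<Rightarrow> ((int \<Rightarrow> real^'q) \<Rightarrow> 'g) \<Rightarrow> 'r \<Rightarrow>
     int \<Rightarrow> (int \<Rightarrow> real^'q) \<Rightarrow> real^'q"
  where "group_variation \<Gamma> act \<rho> r n z =
    vector_derivative (\<lambda>t. act (\<rho> z) (act (param_path \<Gamma> r t) (z 0))) (at 0)"

text \<open>The row vector \<open>{\<Phi>\<^sup>\<alpha>(g \<cdot> u\<^sub>0) Ad(g)}\<close> at \<open>g = \<rho>\<^sub>0\<close>.\<close>

definition frame_row ::
    "(real^'r \<Rightarrow> 'g) \<Rightarrow> ('g \<Rightarrow> real^'q \<Rightarrow> real^'q) \<Rightarrow> (real^'q) set \<Rightarrow> ((int \<Rightarrow> real^'q) \<Rightarrow> 'g) \<Rightarrow>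
     'q \<Rightarrow> int \<Rightarrow> (int \<Rightarrow> real^'q) \<Rightarrow> real^'r"
  where "frame_row \<Gamma> act U \<rho> \<alpha> n z =
    (characteristics \<Gamma> act (act (\<rho> z) (z 0)) $ \<alpha>) v* Ad_matrix \<Gamma> act U (\<rho> z)"

text \<open>\<open>C\<^sup>j\<^sub>\<alpha> S\<^sub>j{\<Phi>\<^sup>\<alpha>\<^sub>0(I) Ad(\<rho>\<^sub>0)}\<close>\<close>

definition law_row ::
    "(real^'r \<Rightarrow> 'g) \<Rightarrow> ('g \<Rightarrow> real^'q \<Rightarrow> real^'q) \<Rightarrow> (real^'q) set \<Rightarrow> ((int \<Rightarrow> real^'q) \<Rightarrow> 'g) \<Rightarrow>
     ((int \<Rightarrow> real^'q) \<Rightarrow> real^'m) \<Rightarrow> int set \<Rightarrow> (int \<Rightarrow> int \<Rightarrow> (int \<Rightarrow> real^'m) \<Rightarrow> real^'q) \<Rightarrow>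
     int \<Rightarrow> (int \<Rightarrow> real^'q) \<Rightarrow> real^'r"
  where "law_row \<Gamma> act U \<rho> \<kappa> S C n z =
    (\<Sum>j\<in>S. \<Sum>\<alpha>\<in>UNIV.
       C j n (invariant_seq \<kappa> z) $ \<alpha> *\<^sub>R shift j (frame_row \<Gamma> act U \<rho> \<alpha>) n z)"

text \<open>Sequences \<open>u\<close> with \<open>H\<^sup>* E\<^sub>\<kappa>(L) = 0\<close>; the point of the prolongation space over \<open>n\<close> is
  \<open>shift_seq n u\<close>.\<close>

definition solutions ::
    "((int \<Rightarrow> 'u) \<Rightarrow> real^'m) \<Rightarrow> (int \<Rightarrow> 'u) set \<Rightarrow> int \<Rightarrow> (int \<Rightarrow> (int \<Rightarrow> real^'m) \<Rightarrow> real) \<Rightarrow>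
     int set \<Rightarrow> (int \<Rightarrow> (int \<Rightarrow> real^'m) \<Rightarrow> real^'q^'m) \<Rightarrow> (int \<Rightarrow> 'u) set"
  where "solutions \<kappa> D J\<^sub>1 L S h = {u \<in> D. \<forall>n.
    adjoint_operator S h (euler_operator J\<^sub>1 L) n (invariant_seq \<kappa> (shift_seq n u)) = 0}"

end

theory Submission
  imports Defs
begin

text \<open>
  Two independent facts about the variation along the group path \<open>\<gamma>\<^sub>r\<close> carry the theorem.

  The first is the formula for \<open>\<sigma>\<close>.  For \<open>g\<close> in the group, \<open>g \<cdot> \<gamma>\<^sub>r(t) \<cdot> u\<^sub>0\<close> has the derivative
  \<open>d(g)(v\<^sub>r(u\<^sub>0))\<close> at \<open>t = 0\<close>, the image of the generator under the Jacobian of the action of \<open>g\<close>.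
  Since \<open>g \<cdot> \<gamma> \<cdot> u = (g \<gamma> g\<^sup>-\<^sup>1) \<cdot> (g \<cdot> u)\<close>, this image is a combination of the generators at
  \<open>g \<cdot> u\<^sub>0\<close>, with coefficients from the derivative of the conjugation \<open>\<gamma> \<mapsto> g \<gamma> g\<^sup>-\<^sup>1\<close> at the identity
  (lemma \<open>frechet_act_orbit_derivative\<close>).  The coefficients are the same at all points \<open>u\<close>, so the
  matrix of this derivative has the property by which the adjoint matrix is defined, and the linear
  independence of the generators makes it the only such matrix (\<open>Ad_matrix_eq\<close>).  Setting \<open>g\<close> to the
  frame gives \<open>\<sigma>\<^sup>\<alpha> = \<Phi>\<^sup>\<alpha>(g \<cdot> u\<^sub>0) Ad(g)\<close> (\<open>group_variation_eq_frame_row\<close>), and the boundary term,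
  being linear in \<open>\<sigma>\<close>, turns into the row vector of the laws.

  The second is \<open>H\<sigma> = 0\<close>.  By the syzygies, \<open>H\<sigma>\<close> is the derivative of the invariants along the curve
  \<open>\<gamma>\<^sub>r(t) \<cdot> z\<close>, on which they are constant (\<open>diff_operator_group_variation\<close>).  On solutions the other
  term on the left of the identity that defines the boundary term vanishes too, and what remains is
  \<open>(S - id) A = 0\<close>.
\<close>

section \<open>Smooth functions on open sets\<close>

lemma C_inf_on_imp_differentiable:
  assumes "C_inf_on S f" "x \<in> S"
  shows "f differentiable (at x)"
proof -
  have "Ck_on (Suc 0) S f"
    using assms(1) unfolding C_inf_on_def by blast
  with assms(2) show ?thesis by simp
qed

text \<open>The derivative of \<open>f(p + A t)\<close> in the direction \<open>v\<close> is the derivative of \<open>f\<close> in the direction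
  \<open>A v\<close>, again composed with the same affine map, so induction on the order of differentiability
  works without a chain rule for higher derivatives.  The function \<open>g\<close> only has to agree with the
  composition on \<open>T\<close>: derivatives at points outside \<open>T\<close> are arbitrary, so an equation between the
  derivatives can only be passed on in the induction for points of \<open>T\<close>.\<close>

lemma Ck_on_compose_affine:
  assumes A: "bounded_linear A" and T: "open T"
    and mem: "\<And>t. t \<in> T \<Longrightarrow> p + A t \<in> S"
    and eq: "\<And>t. t \<in> T \<Longrightarrow> g t = f (p + A t)"
    and f: "Ck_on k S f"
  shows "Ck_on k T g"
  using eq f
proof (induction k arbitrary: f g)
  case 0
  have "continuous_on T (\<lambda>t. p + A t)"
    by (intro continuous_intros linear_continuous_on A)
  then have "continuous_on T (\<lambda>t. f (p + A t))"
    using 0 mem by (auto intro: continuous_on_compose2)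
  then show ?case
    using 0 by (simp cong: continuous_on_cong)
next
  case (Suc k)
  have der: "(g has_derivative (\<lambda>v. frechet_derivative f (at (p + A t)) (A v))) (at t)"
    if t: "t \<in> T" for t
  proof -
    have "(f has_derivative frechet_derivative f (at (p + A t))) (at (p + A t))"
      using Suc.prems(2) mem[OF t] by (simp add: frechet_derivative_works)
    moreover have "((\<lambda>t. p + A t) has_derivative A) (at t)"
      by (auto intro!: derivative_eq_intros bounded_linear_imp_has_derivative A)
    ultimately have "((\<lambda>t. f (p + A t)) has_derivative
        (\<lambda>v. frechet_derivative f (at (p + A t)) (A v))) (at t)"
      by (rule has_derivative_compose[rotated])
    then show ?thesis
      by (rule has_derivative_transform_within_open[OF _ T t]) (simp add: Suc.prems(1))
  qed
  have "Ck_on k T (\<lambda>t. frechet_derivative g (at t) v)" for v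
  proof (rule Suc.IH)
    show "frechet_derivative g (at t) v = frechet_derivative f (at (p + A t)) (A v)"
      if "t \<in> T" for t
      by (simp flip: frechet_derivative_at[OF der[OF that]])
    show "Ck_on k S (\<lambda>x. frechet_derivative f (at x) (A v))"
      using Suc.prems(2) by simp
  qed
  then show ?case
    using der by (auto simp: differentiable_def)
qed

lemma C_inf_on_compose_affine:
  assumes "bounded_linear A" "open T"
    and "\<And>t. t \<in> T \<Longrightarrow> p + A t \<in> S"
    and "\<And>t. t \<in> T \<Longrightarrow> g t = f (p + A t)"
    and "C_inf_on S f"
  shows "C_inf_on T g"
  using assms(5) unfolding C_inf_on_def using Ck_on_compose_affine[OF assms(1,2)] assms(3,4) by blast

lemma has_derivative_transform_nhds:
  assumes "(f has_derivative D) (at x)" "\<forall>\<^sub>F y in nhds x. f y = g y"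
  shows "(g has_derivative D) (at x)"
  using assms(1)
proof (rule has_derivative_transform_eventually)
  show "\<forall>\<^sub>F y in at x. f y = g y"
    using assms(2) unfolding eventually_at_filter by (rule eventually_mono) simp
qed (use eventually_nhds_x_imp_x[OF assms(2)] in auto)

lemma axis_eq_scaleR: "axis r t = t *\<^sub>R (axis r 1 :: real^'r)"
  by (auto simp: axis_def vec_eq_iff)

lemma bounded_linear_axis: "bounded_linear (\<lambda>t. axis r t :: real^'r)"
  by (subst axis_eq_scaleR) (rule bounded_linear_scaleR_left)


section \<open>Charts and translations of a Lie group\<close>

context lie_group
begin

lemma atlas_chart:
  assumes "(V, \<phi>) \<in> \<A>"
  shows "chart X (V, \<phi>)"
  using assms atlas unfolding maximal_atlas_def by blast

lemma chart_at:
  assumes "g \<in> carrier G"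
  obtains V \<phi> where "(V, \<phi>) \<in> \<A>" "g \<in> V"
proof -
  have "g \<in> (\<Union>c\<in>\<A>. fst c)"
    using assms atlas topspace_eq unfolding maximal_atlas_def by simp
  with that show ?thesis by force
qed

lemma chart_openin: "(V, \<phi>) \<in> \<A> \<Longrightarrow> openin X V"
  using atlas_chart unfolding chart_def by auto

lemma chart_carrier: "(V, \<phi>) \<in> \<A> \<Longrightarrow> V \<subseteq> carrier G"
  using chart_openin openin_subset topspace_eq by metis

lemma chart_inj:
  assumes "(V, \<phi>) \<in> \<A>"
  shows "inj_on \<phi> V"
  using atlas_chart[OF assms] topspace_subtopology_subset[OF openin_subset[OF chart_openin[OF assms]]]
    homeomorphic_imp_injective_map unfolding chart_def by fastforce

lemma chart_inverse:
  assumes "(V, \<phi>) \<in> \<A>" "g \<in> V"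
  shows "inv_into V \<phi> (\<phi> g) = g"
  using assms chart_inj by (simp add: inv_into_f_f)

lemma multiplication_differentiable:
  assumes "(V\<^sub>1, \<phi>\<^sub>1) \<in> \<A>" "(V\<^sub>2, \<phi>\<^sub>2) \<in> \<A>" "(V\<^sub>3, \<phi>\<^sub>3) \<in> \<A>"
    and "g \<in> V\<^sub>1" "k \<in> V\<^sub>2" "g \<otimes> k \<in> V\<^sub>3"
  shows "(\<lambda>(a, b). \<phi>\<^sub>3 (inv_into V\<^sub>1 \<phi>\<^sub>1 a \<otimes> inv_into V\<^sub>2 \<phi>\<^sub>2 b)) differentiable (at (\<phi>\<^sub>1 g, \<phi>\<^sub>2 k))"
  by (rule C_inf_on_imp_differentiable[OF mult_smooth[OF assms(1-3)]]) (use assms in blast)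

text \<open>Smoothness of the multiplication refers to charts for both factors; the factor that is held
  fixed is therefore written in a chart around itself, where it becomes a constant argument.\<close>

lemma left_translation_differentiable:
  assumes "(V\<^sub>2, \<phi>\<^sub>2) \<in> \<A>" "(V\<^sub>3, \<phi>\<^sub>3) \<in> \<A>"
    and "g \<in> carrier G" "k \<in> V\<^sub>2" "g \<otimes> k \<in> V\<^sub>3"
  shows "(\<lambda>b. \<phi>\<^sub>3 (g \<otimes> inv_into V\<^sub>2 \<phi>\<^sub>2 b)) differentiable (at (\<phi>\<^sub>2 k))"
proof -
  obtain V \<phi> where V: "(V, \<phi>) \<in> \<A>" "g \<in> V"
    using chart_at[OF assms(3)] .
  have "(\<lambda>b. (\<phi> g, b)) differentiable (at (\<phi>\<^sub>2 k))"
    by (auto simp: differentiable_def intro!: exI derivative_eq_intros)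
  from differentiable_compose[OF multiplication_differentiable[OF V(1) assms(1,2) V(2) assms(4,5)] this]
  show ?thesis by (simp add: chart_inverse[OF V])
qed

lemma right_translation_differentiable:
  assumes "(V\<^sub>1, \<phi>\<^sub>1) \<in> \<A>" "(V\<^sub>3, \<phi>\<^sub>3) \<in> \<A>"
    and "k \<in> carrier G" "g \<in> V\<^sub>1" "g \<otimes> k \<in> V\<^sub>3"
  shows "(\<lambda>a. \<phi>\<^sub>3 (inv_into V\<^sub>1 \<phi>\<^sub>1 a \<otimes> k)) differentiable (at (\<phi>\<^sub>1 g))"
proof -
  obtain V \<phi> where V: "(V, \<phi>) \<in> \<A>" "k \<in> V"
    using chart_at[OF assms(3)] .
  have "(\<lambda>a. (a, \<phi> k)) differentiable (at (\<phi>\<^sub>1 g))"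
    by (auto simp: differentiable_def intro!: exI derivative_eq_intros)
  from differentiable_compose[OF multiplication_differentiable[OF assms(1) V(1) assms(2) assms(4) V(2) assms(5)] this]
  show ?thesis by (simp add: chart_inverse[OF V])
qed

end


section \<open>The parameter chart and conjugation\<close>

context smooth_action
begin

lemma param_inverse: "b \<in> B \<Longrightarrow> inv_into B \<Gamma> (\<Gamma> b) = b"
  by (simp add: \<Gamma>_inj)

lemma param_chart_inverse: "b \<in> B \<Longrightarrow> inv_into (\<Gamma> ` B) (inv_into B \<Gamma>) b = \<Gamma> b"
  using chart_inverse[OF \<Gamma>_chart, of "\<Gamma> b"] by (simp add: param_inverse)

lemma param_chart_image: "inv_into B \<Gamma> ` \<Gamma> ` B = B"
  by (force simp: param_inverse image_iff)

lemma param_carrier: "b \<in> B \<Longrightarrow> \<Gamma> b \<in> carrier G"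
  using chart_carrier[OF \<Gamma>_chart] by blast

lemma param_continuous: "continuous_map (top_of_set B) X \<Gamma>"
proof -
  have "homeomorphic_map (subtopology X (\<Gamma> ` B)) (top_of_set B) (inv_into B \<Gamma>)"
    using atlas_chart[OF \<Gamma>_chart] unfolding chart_def by (simp add: param_chart_image)
  then obtain h where h: "homeomorphic_maps (subtopology X (\<Gamma> ` B)) (top_of_set B) (inv_into B \<Gamma>) h"
    by (auto simp: homeomorphic_map_maps)
  have top: "topspace (subtopology X (\<Gamma> ` B)) = \<Gamma> ` B"
    by (rule topspace_subtopology_subset[OF openin_subset[OF chart_openin[OF \<Gamma>_chart]]])
  have "h b = \<Gamma> b" if "b \<in> B" for b
    using h that top unfolding homeomorphic_maps_def by (metis imageI param_inverse)
  moreover have "continuous_map (top_of_set B) X h"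
    using h unfolding homeomorphic_maps_def by (simp add: continuous_map_in_subtopology)
  ultimately show ?thesis
    by (auto intro: continuous_map_eq)
qed

text \<open>Charts are defined on parts of the group only.  This is what keeps products near the identity
  inside the domain of a chart, so that formulas in coordinates hold near the parameter value \<open>0\<close>.\<close>

lemma translate_param_eventually:
  assumes "g \<in> carrier G" "k \<in> carrier G" "openin X W" "g \<otimes> k \<in> W"
  shows "\<forall>\<^sub>F b in nhds 0. b \<in> B \<and> g \<otimes> \<Gamma> b \<otimes> k \<in> W"
proof -
  have mult: "continuous_map (top_of_set B) X (\<lambda>b. p b \<otimes> q b)"
    if "continuous_map (top_of_set B) X p" "continuous_map (top_of_set B) X q" for p q
    using continuous_map_compose[OF continuous_map_pairedI[OF that] mult_continuous]
    by (simp add: o_def)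
  have "continuous_map (top_of_set B) X (\<lambda>b. g \<otimes> \<Gamma> b \<otimes> k)"
    using assms(1,2) by (intro mult param_continuous) (auto simp: topspace_eq)
  then have "openin (top_of_set B) {b \<in> B. g \<otimes> \<Gamma> b \<otimes> k \<in> W}"
    using assms(3) by (auto simp: continuous_map_def)
  then have "open {b \<in> B. g \<otimes> \<Gamma> b \<otimes> k \<in> W}"
    using open_B openin_open_trans by blast
  then show ?thesis
    using eventually_nhds_in_open[of "{b \<in> B. g \<otimes> \<Gamma> b \<otimes> k \<in> W}" 0] assms zero_in_B
    by (simp add: \<Gamma>_zero)
qed

text \<open>The value is the coordinate vector of the conjugate only as long as the conjugate stays in
  \<open>\<Gamma> ` B\<close>, which holds for \<open>b\<close> near \<open>0\<close>; just the germ at \<open>0\<close> matters.\<close>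

definition conjugation_coords :: "'g \<Rightarrow> real^'r \<Rightarrow> real^'r"
  where "conjugation_coords g b = inv_into B \<Gamma> (g \<otimes> \<Gamma> b \<otimes> inv g)"

lemma conjugation_coords_zero: "g \<in> carrier G \<Longrightarrow> conjugation_coords g 0 = 0"
  using param_inverse[OF zero_in_B] by (simp add: conjugation_coords_def \<Gamma>_zero)

lemma one_in_param: "\<one> \<in> \<Gamma> ` B"
  using zero_in_B \<Gamma>_zero by force

lemma param_conjugation_coords:
  assumes "g \<in> carrier G"
  shows "\<forall>\<^sub>F b in nhds 0. b \<in> B \<and> \<Gamma> (conjugation_coords g b) = g \<otimes> \<Gamma> b \<otimes> inv g"
proof -
  have "\<forall>\<^sub>F b in nhds 0. b \<in> B \<and> g \<otimes> \<Gamma> b \<otimes> inv g \<in> \<Gamma> ` B"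
    using translate_param_eventually[of g "inv g"] assms chart_openin[OF \<Gamma>_chart] one_in_param
    by simp
  then show ?thesis
    by (rule eventually_mono) (auto simp: conjugation_coords_def f_inv_into_f)
qed

text \<open>The products \<open>g \<Gamma>(b)\<close> need not lie in the parameter chart, so conjugation is split into a
  left translation from the parameter chart to a chart around \<open>g\<close> and a right translation back.\<close>

lemma conjugation_coords_differentiable:
  assumes g: "g \<in> carrier G"
  shows "conjugation_coords g differentiable (at 0)"
proof -
  obtain V \<phi> where V: "(V, \<phi>) \<in> \<A>" "g \<in> V"
    using chart_at[OF g] .
  let ?\<gamma> = "inv_into B \<Gamma>"
  let ?p = "\<lambda>b. \<phi> (g \<otimes> inv_into (\<Gamma> ` B) ?\<gamma> b)"
  let ?q = "\<lambda>a. ?\<gamma> (inv_into V \<phi> a \<otimes> inv g)"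
  have p0: "?p 0 = \<phi> g"
    using g by (simp add: param_chart_inverse zero_in_B \<Gamma>_zero)
  have p: "?p differentiable (at 0)"
    using left_translation_differentiable[OF \<Gamma>_chart V(1) g one_in_param] g V(2)
      param_inverse[OF zero_in_B] by (simp add: \<Gamma>_zero)
  have q: "?q differentiable (at (?p 0))"
    unfolding p0
    by (rule right_translation_differentiable[OF V(1) \<Gamma>_chart _ V(2)]) (use g one_in_param in auto)
  from p q have "?q \<circ> ?p differentiable (at 0)"
    by (rule differentiable_chain_at)
  then obtain D where D: "(?q \<circ> ?p has_derivative D) (at 0)"
    by (auto simp: differentiable_def)
  have "\<forall>\<^sub>F b in nhds 0. b \<in> B \<and> g \<otimes> \<Gamma> b \<otimes> \<one> \<in> V"
    using translate_param_eventually[of g \<one> V] g V chart_openin by simp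
  then have eq: "\<forall>\<^sub>F b in nhds 0. (?q \<circ> ?p) b = conjugation_coords g b"
    by (rule eventually_mono)
      (auto simp: conjugation_coords_def param_chart_inverse param_carrier g chart_inverse[OF V(1)])
  have "(conjugation_coords g has_derivative D) (at 0)"
    by (rule has_derivative_transform_nhds[OF D eq])
  then show ?thesis
    by (auto simp: differentiable_def)
qed

end


section \<open>Derivatives of the action and the adjoint matrix\<close>

context smooth_action
begin

lemma act_param_smooth: "C_inf_on (B \<times> U) (\<lambda>(a, x). act (\<Gamma> a) x)"
proof -
  have "C_inf_on (B \<times> U) (\<lambda>(a, x). act (inv_into (\<Gamma> ` B) (inv_into B \<Gamma>) a) x)"
    using act_smooth[OF \<Gamma>_chart] by (simp add: param_chart_image)
  then show ?thesis
    by (rule C_inf_on_compose_affine[where p = 0 and A = "\<lambda>x. x", rotated -1])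
      (auto simp: param_chart_inverse bounded_linear_ident open_Times open_B open_U)
qed

lemma act_one: "x \<in> U \<Longrightarrow> act \<one> x = x"
  using id_eq_one by (metis restrict_apply')

lemma act_differentiable:
  assumes "g \<in> carrier G" "x \<in> U"
  shows "act g differentiable (at x)"
proof -
  obtain V \<phi> where V: "(V, \<phi>) \<in> \<A>" "g \<in> V"
    using chart_at[OF assms(1)] .
  have "(\<lambda>(a, x). act (inv_into V \<phi> a) x) differentiable (at (\<phi> g, x))"
    by (rule C_inf_on_imp_differentiable[OF act_smooth[OF V(1)]]) (use V assms in auto)
  moreover have "(\<lambda>x. (\<phi> g, x)) differentiable (at x)"
    by (auto simp: differentiable_def intro!: exI derivative_eq_intros)
  ultimately have "(\<lambda>x. case (\<phi> g, x) of (a, x) \<Rightarrow> act (inv_into V \<phi> a) x) differentiable (at x)"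
    by (rule differentiable_compose)
  then show ?thesis
    by (simp add: chart_inverse[OF V])
qed

definition orbit_derivative :: "real^'q \<Rightarrow> real^'r \<Rightarrow> real^'q"
  where "orbit_derivative x = frechet_derivative (\<lambda>a. act (\<Gamma> a) x) (at 0)"

lemma orbit_map_has_derivative:
  assumes "x \<in> U"
  shows "((\<lambda>a. act (\<Gamma> a) x) has_derivative orbit_derivative x) (at 0)"
proof -
  have "(\<lambda>(a, x). act (\<Gamma> a) x) differentiable (at (0, x))"
    by (rule C_inf_on_imp_differentiable[OF act_param_smooth]) (use zero_in_B assms in auto)
  moreover have "(\<lambda>a. (a, x)) differentiable (at 0)"
    by (auto simp: differentiable_def intro!: exI derivative_eq_intros)
  ultimately have "(\<lambda>a. case (a, x) of (a, x) \<Rightarrow> act (\<Gamma> a) x) differentiable (at 0)"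
    by (rule differentiable_compose)
  then show ?thesis
    unfolding orbit_derivative_def by (simp add: frechet_derivative_works)
qed

lemma act_param_path_has_vector_derivative:
  assumes "x \<in> U"
  shows "((\<lambda>t. act (param_path \<Gamma> r t) x) has_vector_derivative orbit_derivative x (axis r 1)) (at 0)"
proof -
  have axis: "((\<lambda>t. axis r t :: real^'r) has_derivative (\<lambda>t. axis r t)) (at 0)"
    by (rule bounded_linear_imp_has_derivative[OF bounded_linear_axis])
  have zero: "axis r 0 = (0 :: real^'r)"
    by (simp add: axis_def vec_eq_iff)
  have "((\<lambda>a. act (\<Gamma> a) x) has_derivative orbit_derivative x) (at (axis r 0))"
    using orbit_map_has_derivative[OF assms] by (simp add: zero)
  from has_derivative_compose[OF axis this]
  have "((\<lambda>t. act (param_path \<Gamma> r t) x) has_derivative (\<lambda>t. orbit_derivative x (axis r t))) (at 0)"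
    by (simp add: param_path_def)
  moreover have "orbit_derivative x (axis r t) = t *\<^sub>R orbit_derivative x (axis r 1)" for t
    using linear_scale[OF has_derivative_linear[OF orbit_map_has_derivative[OF assms]], of t "axis r 1"]
    by (subst axis_eq_scaleR)
  ultimately show ?thesis
    unfolding has_vector_derivative_def by (rule has_derivative_eq_rhs[OF _ ext])
qed

lemma generator_eq_orbit_derivative:
  assumes "x \<in> U"
  shows "generator \<Gamma> act r x = orbit_derivative x (axis r 1)"
  unfolding generator_def
  by (rule vector_derivative_at[OF act_param_path_has_vector_derivative[OF assms]])

text \<open>Equivariance of the orbit maps: both sides are derivatives at \<open>b = 0\<close> of
  \<open>g \<cdot> \<Gamma>(b) \<cdot> x = (g \<Gamma>(b) g\<^sup>-\<^sup>1) \<cdot> (g \<cdot> x)\<close>, once by differentiating the action of \<open>g\<close> and once through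
  the coordinates of the conjugate.\<close>

lemma frechet_act_orbit_derivative:
  assumes g: "g \<in> carrier G" and x: "x \<in> U"
  shows "frechet_derivative (act g) (at x) (orbit_derivative x v) =
    orbit_derivative (act g x) (frechet_derivative (conjugation_coords g) (at 0) v)"
proof -
  let ?D = "frechet_derivative (conjugation_coords g) (at 0)"
  have gx: "act g x \<in> U"
    using element_image[OF g x] by simp
  have "((\<lambda>b. act g (act (\<Gamma> b) x)) has_derivative
      (\<lambda>v. frechet_derivative (act g) (at x) (orbit_derivative x v))) (at 0)"
    using act_differentiable[OF g x]
    by (intro has_derivative_compose[OF orbit_map_has_derivative[OF x]])
      (simp add: frechet_derivative_works \<Gamma>_zero act_one x)
  moreover have "((\<lambda>b. act g (act (\<Gamma> b) x)) has_derivative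
      (\<lambda>v. orbit_derivative (act g x) (?D v))) (at 0)"
  proof -
    have "(conjugation_coords g has_derivative ?D) (at 0)"
      using conjugation_coords_differentiable[OF g] by (simp add: frechet_derivative_works)
    then have der: "((\<lambda>b. act (\<Gamma> (conjugation_coords g b)) (act g x)) has_derivative
        (\<lambda>v. orbit_derivative (act g x) (?D v))) (at 0)"
      by (rule has_derivative_compose)
        (simp add: conjugation_coords_zero[OF g] orbit_map_has_derivative[OF gx])
    have "\<forall>\<^sub>F b in nhds 0. act (\<Gamma> (conjugation_coords g b)) (act g x) = act g (act (\<Gamma> b) x)"
      using param_conjugation_coords[OF g]
    proof (rule eventually_mono)
      fix b assume b: "b \<in> B \<and> \<Gamma> (conjugation_coords g b) = g \<otimes> \<Gamma> b \<otimes> inv g"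
      then have "\<Gamma> (conjugation_coords g b) \<otimes> g = g \<otimes> \<Gamma> b"
        using g param_carrier by (simp add: m_assoc)
      then show "act (\<Gamma> (conjugation_coords g b)) (act g x) = act g (act (\<Gamma> b) x)"
        using composition_rule[OF x] b g param_carrier by (metis inv_closed m_closed)
    qed
    then show ?thesis
      by (rule has_derivative_transform_nhds[OF der])
  qed
  ultimately have "(\<lambda>v. frechet_derivative (act g) (at x) (orbit_derivative x v)) =
      (\<lambda>v. orbit_derivative (act g x) (?D v))"
    by (rule has_derivative_unique)
  then show ?thesis
    by (rule fun_cong)
qed

text \<open>Existence comes from \<open>frechet_act_orbit_derivative\<close>, whose matrix of coefficients is
  independent of \<open>x\<close>.  For uniqueness, every point of \<open>U\<close> has the form \<open>g \<cdot> x\<close>, so two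
  candidates give, for each column, a vanishing combination of the generators on all of \<open>U\<close>.\<close>

lemma Ad_matrix_eq:
  assumes g: "g \<in> carrier G"
  shows "Ad_matrix \<Gamma> act U g = matrix (frechet_derivative (conjugation_coords g) (at 0))"
    (is "_ = matrix ?D")
    and Ad_matrix_generator:
      "x \<in> U \<Longrightarrow> frechet_derivative (act g) (at x) (generator \<Gamma> act r x) =
        (\<Sum>s\<in>UNIV. Ad_matrix \<Gamma> act U g $ s $ r *\<^sub>R generator \<Gamma> act s (act g x))"
proof -
  let ?P = "\<lambda>A. \<forall>x\<in>U. \<forall>r. frechet_derivative (act g) (at x) (generator \<Gamma> act r x) =
    (\<Sum>s\<in>UNIV. A $ s $ r *\<^sub>R generator \<Gamma> act s (act g x))"
  have exists: "?P (matrix ?D)"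
  proof (intro ballI allI)
    fix x r assume x: "x \<in> U"
    then have gx: "act g x \<in> U"
      using element_image[OF g x] by simp
    have lin: "linear (orbit_derivative (act g x))"
      by (rule has_derivative_linear[OF orbit_map_has_derivative[OF gx]])
    have "?D (axis r 1) = (\<Sum>s\<in>UNIV. matrix ?D $ s $ r *\<^sub>R axis s 1)"
      by (simp add: matrix_def basis_expansion flip: scalar_mult_eq_scaleR)
    then show "frechet_derivative (act g) (at x) (generator \<Gamma> act r x) =
        (\<Sum>s\<in>UNIV. matrix ?D $ s $ r *\<^sub>R generator \<Gamma> act s (act g x))"
      using frechet_act_orbit_derivative[OF g x]
      by (simp add: generator_eq_orbit_derivative x gx linear_sum[OF lin] linear_scale[OF lin])
  qed
  have unique: "A = A'" if "?P A" "?P A'" for A A'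
  proof -
    have "(\<chi> s. A $ s $ r - A' $ s $ r) = 0" for r
    proof (rule generators_independent, intro ballI)
      fix y assume "y \<in> U"
      then obtain x where "x \<in> U" "y = act g x"
        using surj_prop[OF g] by (metis imageE)
      then show "(\<Sum>s\<in>UNIV. (\<chi> s. A $ s $ r - A' $ s $ r) $ s *\<^sub>R generator \<Gamma> act s y) = 0"
        using that by (simp add: scaleR_left_diff_distrib sum_subtractf)
    qed
    then show ?thesis
      by (simp add: vec_eq_iff)
  qed
  show eq: "Ad_matrix \<Gamma> act U g = matrix ?D"
    unfolding Ad_matrix_def using exists unique by (intro the_equality) blast+
  show "frechet_derivative (act g) (at x) (generator \<Gamma> act r x) =
      (\<Sum>s\<in>UNIV. Ad_matrix \<Gamma> act U g $ s $ r *\<^sub>R generator \<Gamma> act s (act g x))" if "x \<in> U"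
    using exists that unfolding eq by blast
qed

lemma param_path_zero: "param_path \<Gamma> r 0 = \<one>"
  unfolding param_path_def axis_eq_scaleR[of r 0] by (simp add: \<Gamma>_zero)

text \<open>The derivative of \<open>g \<cdot> \<gamma>\<^sub>r(t) \<cdot> u\<^sub>0\<close> is the image of \<open>v\<^sub>r(u\<^sub>0)\<close> under the Jacobian of \<open>g\<close>, which
  the adjoint matrix expresses by the generators at \<open>g \<cdot> u\<^sub>0\<close>; their components form the matrix of
  characteristics there.\<close>

lemma group_variation_eq_frame_row:
  assumes g: "f z \<in> carrier G" and x: "z 0 \<in> U"
  shows "group_variation \<Gamma> act f r n z $ \<alpha> = frame_row \<Gamma> act U f \<alpha> n z $ r"
proof -
  have "((\<lambda>t. act (f z) (act (param_path \<Gamma> r t) (z 0))) has_vector_derivative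
      frechet_derivative (act (f z)) (at (z 0)) (generator \<Gamma> act r (z 0))) (at 0)"
    using vector_derivative_diff_chain_within[OF act_param_path_has_vector_derivative[OF x],
        of "act (f z)" "frechet_derivative (act (f z)) (at (z 0))" r]
      act_differentiable[OF g x]
    by (simp add: o_def frechet_derivative_works param_path_zero act_one x
        generator_eq_orbit_derivative has_derivative_at_withinI)
  then have "group_variation \<Gamma> act f r n z =
      (\<Sum>s\<in>UNIV. Ad_matrix \<Gamma> act U (f z) $ s $ r *\<^sub>R generator \<Gamma> act s (act (f z) (z 0)))"
    unfolding group_variation_def Ad_matrix_generator[OF g x, symmetric]
    by (rule vector_derivative_at)
  then show ?thesis
    by (simp add: frame_row_def vector_matrix_mult_def characteristics_def mult.commute)
qed

lemma open_param_times: "open {t. axis r t \<in> B}"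
proof -
  have "continuous_on UNIV (\<lambda>t. axis r t :: real^'r)"
    by (rule linear_continuous_on[OF bounded_linear_axis])
  then have "open ((\<lambda>t. axis r t) -` B)"
    by (rule open_vimage[OF open_B])
  then show ?thesis
    by (simp add: vimage_def)
qed

lemma param_path_orbit_smooth:
  assumes "x \<in> U"
  shows "C_inf_on {t. axis r t \<in> B} (\<lambda>t. act (param_path \<Gamma> r t) x)"
proof (rule C_inf_on_compose_affine[where p = "(0, x)", OF _ open_param_times _ _ act_param_smooth])
  show "bounded_linear (\<lambda>t. (axis r t :: real^'r, 0 :: real^'q))"
    by (intro bounded_linear_Pair bounded_linear_axis bounded_linear_zero)
qed (use assms in \<open>auto simp: param_path_def\<close>)

end


section \<open>Invariants along group orbits\<close>

context right_moving_frame
begin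

lemma frame_domain_shift: "z \<in> frame_domain J\<^sub>0 J M \<Longrightarrow> shift_seq k z \<in> frame_domain J\<^sub>0 J M"
  by (simp add: frame_domain_def shift_seq_def add.assoc)

lemma frame_domain_component:
  assumes "z \<in> frame_domain J\<^sub>0 J M"
  shows "z j \<in> U"
proof -
  have "restrict (shift_seq j z) {J\<^sub>0..J} \<in> prolongation J\<^sub>0 J U"
    using assms openin_subset[OF M_open] unfolding frame_domain_def by auto
  then have "restrict (shift_seq j z) {J\<^sub>0..J} 0 \<in> U"
    unfolding prolongation_def by (rule PiE_mem) (use window in simp)
  then show ?thesis
    using window by (simp add: shift_seq_def)
qed

lemma frame_domain_invariant:
  assumes "g \<in> carrier G" "z \<in> frame_domain J\<^sub>0 J M"
  shows "prolonged_action UNIV act g z \<in> frame_domain J\<^sub>0 J M"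
proof -
  have "restrict (shift_seq k (prolonged_action UNIV act g z)) {J\<^sub>0..J} =
      prolonged_action {J\<^sub>0..J} act g (restrict (shift_seq k z) {J\<^sub>0..J})" for k
    by (auto simp: shift_seq_def prolonged_action_def)
  then show ?thesis
    using assms M_invariant by (simp add: frame_domain_def)
qed

lemma base_frame_closed:
  assumes "z \<in> frame_domain J\<^sub>0 J M"
  shows "base_frame J\<^sub>0 J \<rho> z \<in> carrier G"
proof -
  have "restrict (shift_seq 0 z) {J\<^sub>0..J} \<in> M"
    using assms unfolding frame_domain_def by blast
  then show ?thesis
    by (simp add: base_frame_def shift_seq_def frame_closed)
qed

text \<open>The curve \<open>\<gamma>\<^sub>r(t) \<cdot> z\<close> is an admissible variation, and \<open>H\<sigma>\<close> is the derivative of \<open>\<kappa>\<close> along it;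
  \<open>\<kappa>\<close> is constant on the group orbit.  The group acts diagonally, so the shift of this variation is
  the variation along the same path at the shifted point, which matches the operators \<open>S\<^sub>j\<close> in \<open>H\<close>.\<close>

lemma diff_operator_group_variation:
  assumes inv: "difference_invariant G act (frame_domain J\<^sub>0 J M) \<kappa>"
    and syz: "syzygies act f (frame_domain J\<^sub>0 J M) \<kappa> S h"
    and z: "z \<in> frame_domain J\<^sub>0 J M"
  shows "diff_operator \<kappa> S h (group_variation \<Gamma> act f r) n z = 0"
proof -
  define v where "v = (\<lambda>t. prolonged_action UNIV act (param_path \<Gamma> r t) z)"
  let ?T = "{t. axis r t \<in> B}"
  have zero: "0 \<in> ?T"
    using zero_in_B by (simp add: axis_def flip: zero_vec_def)
  have v_eq: "v t j = act (param_path \<Gamma> r t) (z j)" for t j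
    by (simp add: v_def prolonged_action_def)
  have v_zero: "v 0 = z"
    using frame_domain_component[OF z] by (simp add: fun_eq_iff v_eq param_path_zero act_one)
  have carrier: "param_path \<Gamma> r t \<in> carrier G" if "t \<in> ?T" for t
    using that by (simp add: param_path_def param_carrier)
  have "C_inf_on ?T (\<lambda>t. v t j)" for j
    unfolding v_eq by (rule param_path_orbit_smooth[OF frame_domain_component[OF z]])
  moreover have "v t \<in> frame_domain J\<^sub>0 J M" if "t \<in> ?T" for t
    unfolding v_def using frame_domain_invariant[OF carrier[OF that] z] .
  ultimately have syz_v: "((\<lambda>s. \<kappa> (v s)) has_vector_derivative
      (\<Sum>j\<in>S. h j (invariant_seq \<kappa> (v 0)) *v
        invariantized_variation act f (\<lambda>s. shift_seq j (v s)) 0)) (at 0)"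
    using syz open_param_times zero unfolding syzygies_def by blast
  have "invariantized_variation act f (\<lambda>s. shift_seq j (v s)) 0 =
      shift j (group_variation \<Gamma> act f r) n z" for j
    by (simp add: invariantized_variation_def shift_def group_variation_def v_zero)
      (simp add: shift_seq_def v_eq)
  with syz_v have "((\<lambda>s. \<kappa> (v s)) has_vector_derivative
      diff_operator \<kappa> S h (group_variation \<Gamma> act f r) n z) (at 0)"
    by (simp add: diff_operator_def v_zero)
  moreover have "((\<lambda>s. \<kappa> (v s)) has_vector_derivative 0) (at 0)"
  proof (rule has_vector_derivative_transform_within_open[OF has_vector_derivative_const open_param_times zero])
    fix t assume "t \<in> ?T"
    then show "\<kappa> z = \<kappa> (v t)"
      using inv z carrier unfolding difference_invariant_def v_def by simp
  qed
  ultimately show ?thesis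
    by (rule vector_derivative_unique_at)
qed

end


section \<open>The conservation laws\<close>

lemma boundary_term_eq_law_row:
  assumes "\<And>j \<alpha>. \<sigma> (n + j) (shift_seq j z) $ \<alpha> =
    frame_row \<Gamma> act U f \<alpha> (n + j) (shift_seq j z) $ r"
  shows "boundary_term \<kappa> S C \<sigma> n z = law_row \<Gamma> act U f \<kappa> S C n z $ r"
  using assms by (simp add: boundary_term_def law_row_def shift_def)

theorem theorem7p1:
  fixes G :: "'g monoid"
    and X :: "'g topology"
    and \<A> :: "('g set \<times> ('g \<Rightarrow> real^'r)) set"
    and U :: "(real^'q) set"
    and act :: "'g \<Rightarrow> real^'q \<Rightarrow> real^'q"
    and \<Gamma> :: "real^'r \<Rightarrow> 'g"
    and B :: "(real^'r) set"
    and J\<^sub>0 J N J\<^sub>1 :: int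
    and M K D :: "(int \<Rightarrow> real^'q) set"
    and \<rho> \<rho>\<^sub>0 :: "(int \<Rightarrow> real^'q) \<Rightarrow> 'g"
    and \<kappa> :: "(int \<Rightarrow> real^'q) \<Rightarrow> real^'m"
    and Lu :: "int \<Rightarrow> (int \<Rightarrow> real^'q) \<Rightarrow> real"
    and L :: "int \<Rightarrow> (int \<Rightarrow> real^'m) \<Rightarrow> real"
    and S S' :: "int set"
    and h :: "int \<Rightarrow> (int \<Rightarrow> real^'m) \<Rightarrow> real^'q^'m"
    and C :: "int \<Rightarrow> int \<Rightarrow> (int \<Rightarrow> real^'m) \<Rightarrow> real^'q"
  assumes frame: "right_moving_frame G X \<A> U act \<Gamma> B J\<^sub>0 J M K \<rho>"
    and domain: "D = frame_domain J\<^sub>0 J M"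
    and base_frame: "\<rho>\<^sub>0 = base_frame J\<^sub>0 J \<rho>"
    and Lagrangian: "0 \<le> N" "\<And>n. local_smooth_on 0 N D (Lu n)"
    and Lagrangian_invariant:
      "\<And>n g z. \<lbrakk> g \<in> carrier G; z \<in> D \<rbrakk> \<Longrightarrow> Lu n (prolonged_action UNIV act g z) = Lu n z"
    and generating: "generating_invariants G act D \<kappa>"
    and invariant_Lagrangian:
      "0 \<le> J\<^sub>1" "\<And>n. local_smooth_near 0 J\<^sub>1 (invariant_seq \<kappa> ` D) (L n)"
      "same_functional D Lu (\<lambda>n z. L n (invariant_seq \<kappa> z))"
    and H_finite: "finite S"
    and H_coefficients:
      "\<And>j. j \<in> S \<Longrightarrow> \<exists>A B'. local_smooth_near A B' (invariant_seq \<kappa> ` D) (h j)"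
    and syzygies: "syzygies act \<rho>\<^sub>0 D \<kappa> S h"
    and C_finite: "finite S'"
    and C_coefficients:
      "\<And>j. j \<in> S' \<Longrightarrow> \<exists>A B'. \<forall>n. local_smooth_near A B' (invariant_seq \<kappa> ` D) (C j n)"
    and boundary: "is_boundary_term \<kappa> D J\<^sub>1 L S h S' C"
  shows
    "(\<forall>n r \<alpha>. \<forall>z\<in>D.
        group_variation \<Gamma> act \<rho>\<^sub>0 r n z $ \<alpha> = frame_row \<Gamma> act U \<rho>\<^sub>0 \<alpha> n z $ r) \<and>
     (\<forall>n r. \<forall>z\<in>D.
        boundary_term \<kappa> S' C (group_variation \<Gamma> act \<rho>\<^sub>0 r) n z =
        law_row \<Gamma> act U \<rho>\<^sub>0 \<kappa> S' C n z $ r) \<and>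
     (\<forall>u\<in>solutions \<kappa> D J\<^sub>1 L S h. \<forall>n r.
        shift 1 (boundary_term \<kappa> S' C (group_variation \<Gamma> act \<rho>\<^sub>0 r)) n (shift_seq n u) -
        boundary_term \<kappa> S' C (group_variation \<Gamma> act \<rho>\<^sub>0 r) n (shift_seq n u) = 0) \<and>
     (\<forall>u\<in>solutions \<kappa> D J\<^sub>1 L S h. \<forall>n.
        shift 1 (law_row \<Gamma> act U \<rho>\<^sub>0 \<kappa> S' C) n (shift_seq n u) -
        law_row \<Gamma> act U \<rho>\<^sub>0 \<kappa> S' C n (shift_seq n u) = 0)"
proof -
  interpret right_moving_frame G X \<A> U act \<Gamma> B J\<^sub>0 J M K \<rho>
    by (rule frame)
  let ?\<sigma> = "group_variation \<Gamma> act \<rho>\<^sub>0" and ?A = "\<lambda>r. boundary_term \<kappa> S' C (group_variation \<Gamma> act \<rho>\<^sub>0 r)"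
    and ?law = "law_row \<Gamma> act U \<rho>\<^sub>0 \<kappa> S' C"
  have D_shift: "shift_seq k z \<in> D" if "z \<in> D" for k z
    using frame_domain_shift that domain by simp
  have replace: "?\<sigma> r n z $ \<alpha> = frame_row \<Gamma> act U \<rho>\<^sub>0 \<alpha> n z $ r" if "z \<in> D" for n r \<alpha> z
    using that unfolding domain base_frame
    by (intro group_variation_eq_frame_row base_frame_closed frame_domain_component)
  have law: "?A r n z = ?law n z $ r" if "z \<in> D" for n r z
    by (rule boundary_term_eq_law_row) (rule replace[OF D_shift[OF that]])
  have conserved: "shift 1 (?A r) n (shift_seq n u) - ?A r n (shift_seq n u) = 0"
    if u: "u \<in> solutions \<kappa> D J\<^sub>1 L S h" for u n r
  proof -
    have z: "shift_seq n u \<in> D"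
      using u D_shift by (simp add: solutions_def)
    have "diff_operator \<kappa> S h (?\<sigma> r) n (shift_seq n u) = 0"
      using generating syzygies z unfolding domain generating_invariants_def
      by (blast intro: diff_operator_group_variation)
    moreover have "adjoint_operator S h (euler_operator J\<^sub>1 L) n (invariant_seq \<kappa> (shift_seq n u)) = 0"
      using u by (simp add: solutions_def)
    ultimately show ?thesis
      using boundary z unfolding is_boundary_term_def by (metis diff_self inner_zero_left inner_zero_right)
  qed
  have "shift 1 ?law n (shift_seq n u) - ?law n (shift_seq n u) = 0"
    if u: "u \<in> solutions \<kappa> D J\<^sub>1 L S h" for u n
  proof -
    have z: "shift_seq n u \<in> D"
      using u D_shift by (simp add: solutions_def)
    have "(shift 1 ?law n (shift_seq n u) - ?law n (shift_seq n u)) $ r =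
        shift 1 (?A r) n (shift_seq n u) - ?A r n (shift_seq n u)" for r
      by (simp add: shift_def law z D_shift)
    then show ?thesis
      by (simp add: vec_eq_iff conserved[OF u])
  qed
  then show ?thesis
    using replace law conserved by blast
qed

end
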